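(* Let $K$ be a number field and $\gamma=(\theta_n)_{n\ge1}$ with each $\theta_n\in K[x]$ quadratic and each $\gamma_n$ irreducible over $K$. If $H_n=\mathrm{Gal}(K_n(\gamma)/K_{n-1}(\gamma))$ is non-trivial for all sufficiently large $n$, then the fixed-point process of $G_\infty$ is an eventual martingale.
   Context: $\gamma_n=\theta_1\circ\cdots\circ\theta_n$, $K_n(\gamma)$ is the splitting field of $\gamma_n$ over $K$ ($K_0(\gamma)=K$), $G_n=\mathrm{Gal}(K_n(\gamma)/K)$ and $G_\infty=\varprojlim G_n$, which acts on the root set $R_n$ of $\gamma_n$ for each $n$. Let $\mathbf P$ be the Haar probability measure on $G_\infty$. The fixed-point process is the sequence of random variables $X_1,X_2,\dots$ on $(G_\infty,\mathbf P)$ with $X_n(g)$ the number of elements of $R_n$ fixed by $g$. An integer-valued process $(Y_0,Y_1,\dots)$ is a martingale if $E(Y_n\mid Y_0=t_0,\dots,Y_{n-1}=t_{n-1})=t_{n-1}$ for all $n\ge1$ and all integers $t_i$; a process is an eventual martingale if for some $n_0\ge1$ the tail process $(X_{n_0},X_{n_0+1},\dots)$ is a martingale. *)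

theory Defs
  imports
    "HOL-Algebra.Algebra"
    "HOL-Algebra.Algebraic_Closure_Type"
    "HOL-Computational_Algebra.Computational_Algebra"
    "HOL-Probability.Probability"
begin

subsection \<open>Number fields, splitting fields, Galois groups\<close>

definition number_field :: "'a::field_char_0 itself \<Rightarrow> bool" where
  "number_field _ \<longleftrightarrow>
     (\<exists>B. finite_dimensional_vector_space (\<lambda>(q::rat) (x::'a). of_rat q * x) B)"

text \<open>All algebraic extensions of the field \<open>'a\<close> are taken inside \<open>'a alg_closure\<close>,
  in which \<open>'a\<close> is embedded by \<^const>\<open>to_ac\<close>.\<close>

abbreviation ac_ring :: "'a::field alg_closure ring" where
  "ac_ring \<equiv> ring_of_type_algebra"

definition ac_roots :: "'a::field poly \<Rightarrow> 'a alg_closure set" where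
  "ac_roots p = {x. poly (map_poly to_ac p) x = 0}"

definition splitting_field :: "'a::field poly \<Rightarrow> 'a alg_closure set" where
  "splitting_field p = generate_field ac_ring (range to_ac \<union> ac_roots p)"

text \<open>Automorphisms of \<open>L\<close> are, as elements of \<^const>\<open>BijGroup\<close>, extensional: they are
  \<^const>\<open>undefined\<close> outside \<open>L\<close>.\<close>

definition galois_group ::
  "('a, 'b) ring_scheme \<Rightarrow> 'a set \<Rightarrow> 'a set \<Rightarrow> ('a \<Rightarrow> 'a) monoid" where
  "galois_group R L F = BijGroup L
     \<lparr>carrier := {\<sigma> \<in> Bij L. \<sigma> \<in> ring_hom (R\<lparr>carrier := L\<rparr>) (R\<lparr>carrier := L\<rparr>)
                               \<and> (\<forall>x\<in>F. \<sigma> x = x)}\<rparr>"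

lemma group_galois_group:
  assumes L: "subring L R" and F: "F \<subseteq> L"
  shows "group (galois_group R L F)"
proof -
  let ?C = "{\<sigma> \<in> Bij L. \<sigma> \<in> ring_hom (R\<lparr>carrier := L\<rparr>) (R\<lparr>carrier := L\<rparr>)
                        \<and> (\<forall>x\<in>F. \<sigma> x = x)}"
  have cl: "x \<otimes>\<^bsub>R\<^esub> y \<in> L" "x \<oplus>\<^bsub>R\<^esub> y \<in> L" if "x \<in> L" "y \<in> L" for x y
    using subringE(6,7)[OF L] that by auto
  have one: "\<one>\<^bsub>R\<^esub> \<in> L"
    by (rule subringE(3)[OF L])
  have "subgroup ?C (BijGroup L)"
  proof (rule subgroup.intro)
    show "?C \<subseteq> carrier (BijGroup L)"
      by (auto simp: BijGroup_def)
    show "x \<otimes>\<^bsub>BijGroup L\<^esub> y \<in> ?C" if "x \<in> ?C" "y \<in> ?C" for x y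
    proof -
      have b: "x \<in> Bij L" "y \<in> Bij L" using that by auto
      then have m: "y a \<in> L" if "a \<in> L" for a
        using that Bij_imp_funcset by blast
      have "compose L x y \<in> ring_hom (R\<lparr>carrier := L\<rparr>) (R\<lparr>carrier := L\<rparr>)"
        using that m cl one b[THEN Bij_imp_funcset]
        by (auto simp: ring_hom_def compose_def)
      moreover have "\<forall>a\<in>F. compose L x y a = a"
        using that F by (auto simp: compose_def)
      ultimately show ?thesis
        using b by (simp add: BijGroup_def compose_Bij)
    qed
    show "\<one>\<^bsub>BijGroup L\<^esub> \<in> ?C"
      using cl one F by (auto simp: BijGroup_def id_Bij ring_hom_def)
    show "inv\<^bsub>BijGroup L\<^esub> x \<in> ?C" if x: "x \<in> ?C" for x
    proof -
      have b: "x \<in> Bij L" using x by auto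
      have inj: "inj_on x L"
        using b by (auto simp: Bij_def bij_betw_def)
      let ?i = "\<lambda>a\<in>L. inv_into L x a"
      have m: "inv_into L x a \<in> L" if "a \<in> L" for a
        using b that by (rule Bij_inv_into_mem)
      have fx: "x a = a" if "a \<in> F" for a using x that by auto
      have h: "x (a \<otimes>\<^bsub>R\<^esub> c) = x a \<otimes>\<^bsub>R\<^esub> x c" "x (a \<oplus>\<^bsub>R\<^esub> c) = x a \<oplus>\<^bsub>R\<^esub> x c" "x \<one>\<^bsub>R\<^esub> = \<one>\<^bsub>R\<^esub>"
        if "a \<in> L" "c \<in> L" for a c
        using x that by (auto simp: ring_hom_def)
      have fixed: "inv_into L x a = a" if "a \<in> L" "x a = a" for a
        using inv_into_f_f[OF inj, of a] that by simp
      have "?i \<in> ring_hom (R\<lparr>carrier := L\<rparr>) (R\<lparr>carrier := L\<rparr>)"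
        using m cl one h fixed
          Bij_inv_into_lemma[of L x "\<lambda>a c. a \<otimes>\<^bsub>R\<^esub> c"] Bij_inv_into_lemma[of L x "\<lambda>a c. a \<oplus>\<^bsub>R\<^esub> c"] b
        by (auto simp: ring_hom_def)
      moreover have "\<forall>a\<in>F. ?i a = a"
        using F fx fixed by auto
      ultimately show ?thesis
        using b by (simp add: inv_BijGroup restrict_inv_into_Bij)
    qed
  qed
  then show ?thesis
    unfolding galois_group_def
    by (rule subgroup.subgroup_is_group) (rule group_BijGroup)
qed


subsection \<open>Inverse limits and Haar probability measures\<close>

text \<open>The limit of a sequence of groups with transition maps \<open>r n : G (Suc n) \<rightarrow> G n\<close>.\<close>

definition inverse_limit ::
  "(nat \<Rightarrow> 'g monoid) \<Rightarrow> (nat \<Rightarrow> 'g \<Rightarrow> 'g) \<Rightarrow> (nat \<Rightarrow> 'g) monoid" where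
  "inverse_limit G r = product_group UNIV G
     \<lparr>carrier := {g \<in> carrier (product_group UNIV G). \<forall>n. r n (g (Suc n)) = g n}\<rparr>"

definition inverse_limit_topology ::
  "(nat \<Rightarrow> 'g monoid) \<Rightarrow> (nat \<Rightarrow> 'g \<Rightarrow> 'g) \<Rightarrow> (nat \<Rightarrow> 'g) topology" where
  "inverse_limit_topology G r =
     subtopology (product_topology (\<lambda>n. discrete_topology (carrier (G n))) UNIV)
                 (carrier (inverse_limit G r))"

text \<open>A left-invariant Borel probability measure. Regularity is not required: it is automatic
  for finite Borel measures on compact metrizable groups, such as a limit of a sequence of finite
  groups.\<close>

definition haar_prob_measure ::
  "('g, 'b) monoid_scheme \<Rightarrow> 'g topology \<Rightarrow> 'g measure \<Rightarrow> bool" where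
  "haar_prob_measure G T P \<longleftrightarrow>
     prob_space P \<and> space P = carrier G \<and>
     sets P = sigma_sets (carrier G) {U. openin T U} \<and>
     (\<forall>g\<in>carrier G. \<forall>A\<in>sets P. emeasure P (g <#\<^bsub>G\<^esub> A) = emeasure P A)"


subsection \<open>Martingales\<close>

definition event_expectation :: "'w measure \<Rightarrow> ('w \<Rightarrow> real) \<Rightarrow> 'w set \<Rightarrow> real" where
  "event_expectation M Y A = (LINT \<omega>:A|M. Y \<omega>) / measure M A"

text \<open>As usual, \<open>E(Y n | Y 0 = t 0, \<dots>, Y (n-1) = t (n-1)) = t (n-1)\<close> is required when the
  conditioning event has positive probability (otherwise the left-hand side is not defined), and
  it includes that the conditional expectation exists. Integrability has to be stated because the
  Bochner integral of a non-integrable function is 0.\<close>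

definition martingale :: "'w measure \<Rightarrow> (nat \<Rightarrow> 'w \<Rightarrow> int) \<Rightarrow> bool" where
  "martingale M Y \<longleftrightarrow>
     (\<forall>n. Y n \<in> measurable M (count_space UNIV)) \<and>
     (\<forall>n\<ge>1. \<forall>t :: nat \<Rightarrow> int.
        let A = {\<omega> \<in> space M. \<forall>i<n. Y i \<omega> = t i} in
        measure M A > 0 \<longrightarrow>
          set_integrable M A (\<lambda>\<omega>. real_of_int (Y n \<omega>)) \<and>
          event_expectation M (\<lambda>\<omega>. real_of_int (Y n \<omega>)) A = real_of_int (t (n - 1)))"

definition eventual_martingale :: "'w measure \<Rightarrow> (nat \<Rightarrow> 'w \<Rightarrow> int) \<Rightarrow> bool" where
  "eventual_martingale M Y \<longleftrightarrow> (\<exists>n0\<ge>1. martingale M (\<lambda>k. Y (n0 + k)))"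


subsection \<open>The tower attached to a sequence of polynomials\<close>

text \<open>\<open>iter_comp \<theta> n\<close> is \<open>\<theta> 1 \<circ> \<dots> \<circ> \<theta> n\<close>; the value \<open>\<theta> 0\<close> is never used. For \<open>n = 0\<close> it is
  the polynomial \<open>x\<close>, whose splitting field is the base field.\<close>

primrec iter_comp :: "(nat \<Rightarrow> 'a::comm_ring_1 poly) \<Rightarrow> nat \<Rightarrow> 'a poly" where
  "iter_comp \<theta> 0 = [:0, 1:]"
| "iter_comp \<theta> (Suc n) = pcompose (iter_comp \<theta> n) (\<theta> (Suc n))"

definition tower_field :: "(nat \<Rightarrow> 'a::field poly) \<Rightarrow> nat \<Rightarrow> 'a alg_closure set" where
  "tower_field \<theta> n = splitting_field (iter_comp \<theta> n)"

lemma tower_field_0: "tower_field \<theta> 0 = range to_ac"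
proof -
  interpret F: field "ac_ring :: 'a alg_closure ring"
    by (rule field_from_type_algebra)
  have [simp]: "\<ominus>\<^bsub>ac_ring\<^esub> x = - x" for x :: "'a alg_closure"
    by (rule F.minus_equality) (auto simp: ring_of_type_algebra_def)
  have inv: "inv\<^bsub>ac_ring\<^esub> x = inverse x" if "x \<noteq> 0" for x :: "'a alg_closure"
    by (rule F.comm_inv_char) (use that in \<open>auto simp: ring_of_type_algebra_def\<close>)
  have [simp]: "\<one>\<^bsub>ac_ring\<^esub> = (1 :: 'a alg_closure)" "\<zero>\<^bsub>ac_ring\<^esub> = (0 :: 'a alg_closure)"
    "x \<oplus>\<^bsub>ac_ring\<^esub> y = x + y" "x \<otimes>\<^bsub>ac_ring\<^esub> y = x * y" for x y :: "'a alg_closure"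
    by (simp_all add: ring_of_type_algebra_def)
  have "x \<in> range to_ac"
    if "x \<in> generate_field ac_ring (range to_ac \<union> ac_roots [:0, 1:])" for x :: "'a alg_closure"
    using that
  proof (induction rule: generate_field.induct)
    case one
    show ?case by (simp add: range_eqI[of _ _ 1])
  next
    case (incl h)
    then show ?case by (auto simp: ac_roots_def map_poly_pCons intro: range_eqI[of _ _ 0])
  next
    case (a_inv h)
    then obtain a where "h = to_ac a" by blast
    then show ?case by (simp add: range_eqI[of _ _ "- a"])
  next
    case (m_inv h)
    then obtain a where "h = to_ac a" by blast
    with m_inv show ?case by (simp add: inv range_eqI[of _ _ "inverse a"])
  next
    case (eng_add h1 h2)
    then obtain a b where "h1 = to_ac a" "h2 = to_ac b" by blast
    then show ?case by (simp add: range_eqI[of _ _ "a + b"])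
  next
    case (eng_mult h1 h2)
    then obtain a b where "h1 = to_ac a" "h2 = to_ac b" by blast
    then show ?case by (simp add: range_eqI[of _ _ "a * b"])
  qed
  then show ?thesis
    by (auto simp: tower_field_def splitting_field_def intro: generate_field.incl)
qed

definition tower_group ::
  "(nat \<Rightarrow> 'a::field poly) \<Rightarrow> nat \<Rightarrow> ('a alg_closure \<Rightarrow> 'a alg_closure) monoid" where
  "tower_group \<theta> n = galois_group ac_ring (tower_field \<theta> n) (range to_ac)"

definition tower_kernel ::
  "(nat \<Rightarrow> 'a::field poly) \<Rightarrow> nat \<Rightarrow> ('a alg_closure \<Rightarrow> 'a alg_closure) monoid" where
  "tower_kernel \<theta> n = galois_group ac_ring (tower_field \<theta> n) (tower_field \<theta> (n - 1))"

definition tower_restrict ::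
  "(nat \<Rightarrow> 'a::field poly) \<Rightarrow> nat \<Rightarrow>
   ('a alg_closure \<Rightarrow> 'a alg_closure) \<Rightarrow> 'a alg_closure \<Rightarrow> 'a alg_closure" where
  "tower_restrict \<theta> n \<sigma> = restrict \<sigma> (tower_field \<theta> n)"

definition limit_group ::
  "(nat \<Rightarrow> 'a::field poly) \<Rightarrow> (nat \<Rightarrow> 'a alg_closure \<Rightarrow> 'a alg_closure) monoid" where
  "limit_group \<theta> = inverse_limit (tower_group \<theta>) (tower_restrict \<theta>)"

definition limit_topology ::
  "(nat \<Rightarrow> 'a::field poly) \<Rightarrow> (nat \<Rightarrow> 'a alg_closure \<Rightarrow> 'a alg_closure) topology" where
  "limit_topology \<theta> = inverse_limit_topology (tower_group \<theta>) (tower_restrict \<theta>)"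

text \<open>An element \<open>g\<close> of the limit acts on the roots of \<open>iter_comp \<theta> n\<close> through its component
  \<open>g n\<close>.\<close>

definition fixed_point_process ::
  "(nat \<Rightarrow> 'a::field poly) \<Rightarrow> nat \<Rightarrow> (nat \<Rightarrow> 'a alg_closure \<Rightarrow> 'a alg_closure) \<Rightarrow> int" where
  "fixed_point_process \<theta> n g = int (card {x \<in> ac_roots (iter_comp \<theta> n). g n x = x})"

end

theory Submission
  imports Defs
begin

text \<open>Every element of the kernel at level \<open>n + 1\<close> extends to an automorphism \<open>\<eta>\<close> of the algebraic
  closure that fixes \<open>K n\<close> pointwise. If the kernel is nontrivial, then by transitivity on the roots of
  level \<open>n\<close> there is for each such root \<open>b\<close> an \<open>\<eta>\<close> that swaps the two roots above \<open>b\<close>. Left translation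
  by \<open>\<eta>\<close> preserves Haar measure and all events up to level \<open>n\<close>, and on the event that \<open>b\<close> is fixed it
  exchanges the case where both roots above \<open>b\<close> are fixed with the case where they are swapped. So both
  cases have conditional probability one half, and each fixed \<open>b\<close> contributes on average exactly one
  fixed point at level \<open>n + 1\<close>.\<close>

subsection \<open>Automorphisms of the algebraic closure\<close>

lemma map_poly_to_ac_add: "map_poly to_ac (p + q) = map_poly to_ac p + map_poly to_ac q"
  by (simp add: poly_eq_iff coeff_map_poly)

lemma map_poly_to_ac_mult: "map_poly to_ac (p * q) = map_poly to_ac p * map_poly to_ac q"
  by (simp add: poly_eq_iff coeff_map_poly coeff_mult to_ac_sum)

text \<open>Graphs of homomorphisms on rings between the base field and its algebraic closure. Closure under
  inverses need not be assumed, because the extension is algebraic.\<close>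

locale partial_hom =
  fixes G :: "('a::field alg_closure \<times> 'a alg_closure) set"
  assumes const: "(to_ac a, to_ac a) \<in> G"
    and add: "(x, y) \<in> G \<Longrightarrow> (x', y') \<in> G \<Longrightarrow> (x + x', y + y') \<in> G"
    and mult: "(x, y) \<in> G \<Longrightarrow> (x', y') \<in> G \<Longrightarrow> (x * x', y * y') \<in> G"
    and zero_left: "(0, y) \<in> G \<Longrightarrow> y = 0"
begin

lemma zero: "(0, 0) \<in> G"
  using const[of 0] by simp

lemma one: "(1, 1) \<in> G"
  using const[of 1] by simp

lemma uminus: "(x, y) \<in> G \<Longrightarrow> (- x, - y) \<in> G"
  using mult[OF const[of "-1"]] by fastforce

lemma diff: "(x, y) \<in> G \<Longrightarrow> (x', y') \<in> G \<Longrightarrow> (x - x', y - y') \<in> G"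
  using add[OF _ uminus] by fastforce

lemma unique: "(x, y) \<in> G \<Longrightarrow> (x, y') \<in> G \<Longrightarrow> y = y'"
  using diff[of x y x y'] zero_left[of "y - y'"] by simp

lemma sum: "(\<And>i. i \<in> I \<Longrightarrow> (f i, g i) \<in> G) \<Longrightarrow> (sum f I, sum g I) \<in> G"
  by (induction I rule: infinite_finite_induct) (auto intro: zero add)

text \<open>Coefficientwise image of a polynomial under the homomorphism with graph
  \<open>G\<close>. It is a relation because that homomorphism is defined on \<open>Domain G\<close>
  only.\<close>

definition rel :: "'a alg_closure poly \<Rightarrow> 'a alg_closure poly \<Rightarrow> bool" where
  "rel p q \<longleftrightarrow> (\<forall>i. (Polynomial.coeff p i, Polynomial.coeff q i) \<in> G)"

lemma rel_0_left: "rel 0 q \<Longrightarrow> q = 0"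
  by (auto simp: rel_def poly_eq_iff dest: zero_left)

lemma rel_0: "rel 0 0"
  by (auto simp: rel_def zero)

lemma rel_pCons: "rel (pCons a p) (pCons b q) \<longleftrightarrow> (a, b) \<in> G \<and> rel p q"
  by (auto simp: rel_def coeff_pCons split: nat.splits)

lemma rel_add: "rel p q \<Longrightarrow> rel p' q' \<Longrightarrow> rel (p + p') (q + q')"
  by (auto simp: rel_def intro: add)

lemma rel_diff: "rel p q \<Longrightarrow> rel p' q' \<Longrightarrow> rel (p - p') (q - q')"
  by (auto simp: rel_def intro: diff)

lemma rel_mult: "rel p q \<Longrightarrow> rel p' q' \<Longrightarrow> rel (p * p') (q * q')"
  by (auto simp: rel_def coeff_mult intro: sum mult)

lemma rel_monom: "(a, b) \<in> G \<Longrightarrow> rel (Polynomial.monom a n) (Polynomial.monom b n)"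
  by (auto simp: rel_def zero)

lemma rel_const: "rel (map_poly to_ac p) (map_poly to_ac p)"
  by (auto simp: rel_def coeff_map_poly const)

lemma poly_rel:
  assumes "(x, y) \<in> G"
  shows "rel p q \<Longrightarrow> (poly p x, poly q y) \<in> G"
proof (induction p arbitrary: q)
  case 0
  then show ?case using rel_0_left zero by force
next
  case (pCons a p)
  obtain b q' where q: "q = pCons b q'" by (cases q)
  show ?case
    using pCons.prems pCons.IH assms by (auto simp: q rel_pCons intro!: add mult)
qed

text \<open>An algebraic relation for \<open>x\<close> with nonzero constant term exhibits the
  inverse of \<open>x\<close> as a polynomial in \<open>x\<close> over the base field, and such
  polynomials stay in the domain.\<close>

lemma inverse_in_Domain:
  assumes "(x, y) \<in> G"
  shows "\<exists>z. (inverse x, z) \<in> G"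
proof (cases "x = 0")
  case True
  then show ?thesis using zero by auto
next
  case False
  have "\<exists>z. (inverse x, z) \<in> G"
    if "p \<noteq> 0" "poly (map_poly to_ac p) x = 0" for p
    using that
  proof (induction p)
    case 0
    then show ?case by simp
  next
    case (pCons a p)
    let ?p = "map_poly to_ac p"
    have eq: "to_ac a + x * poly ?p x = 0"
      using pCons.prems by (simp add: map_poly_pCons)
    show ?case
    proof (cases "a = 0")
      case True
      then show ?thesis using pCons eq False by auto
    next
      case a: False
      have "(poly ?p x, poly ?p y) \<in> G"
        by (rule poly_rel[OF assms rel_const])
      then have "(to_ac (- inverse a) * poly ?p x, to_ac (- inverse a) * poly ?p y) \<in> G"
        by (intro mult const)
      moreover have "to_ac (- inverse a) * poly ?p x = inverse x"
      proof (rule inverse_unique[symmetric])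
        have "x * poly ?p x = - to_ac a" using eq by (simp add: add_eq_0_iff)
        then show "x * (to_ac (- inverse a) * poly ?p x) = 1"
          using a by (simp add: mult.left_commute[of x])
      qed
      ultimately show ?thesis by auto
    qed
  qed
  then show ?thesis using alg_closure_algebraic[of x] by metis
qed

lemma inverse:
  assumes "(x, y) \<in> G"
  shows "(inverse x, inverse y) \<in> G"
proof (cases "x = 0")
  case True
  then show ?thesis using assms zero zero_left[of y] by auto
next
  case False
  obtain z where z: "(inverse x, z) \<in> G"
    using inverse_in_Domain[OF assms] by blast
  have "(1, y * z) \<in> G" using mult[OF assms z] False by simp
  then have "y * z = 1" using unique one by blast
  then show ?thesis using z inverse_unique by metis
qed

text \<open>An invertible element cannot go to 0: otherwise 1 would go to both 0 and 1.\<close>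

lemma zero_right: "(x, 0) \<in> G \<Longrightarrow> x = 0"
proof (rule ccontr)
  assume "(x, 0) \<in> G" "x \<noteq> 0"
  with mult[OF this(1) inverse[OF this(1)]] have "(1, 0) \<in> G" by simp
  then show False using unique one by fastforce
qed

lemma rel_degree:
  assumes "rel p q"
  shows "Polynomial.degree q = Polynomial.degree p"
proof -
  have "Polynomial.coeff p i = 0 \<longleftrightarrow> Polynomial.coeff q i = 0" for i
    using assms zero_left zero_right unfolding rel_def by metis
  then show ?thesis by (auto simp: Polynomial.degree_def)
qed

text \<open>Evaluation at \<open>x\<close> and \<open>y\<close> respects sums and products whatever
  the two points are; the premise is what makes the value at 0 unambiguous.\<close>

lemma adjoin:
  assumes "\<And>p q. rel p q \<Longrightarrow> poly p x = 0 \<Longrightarrow> poly q y = 0"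
  shows "partial_hom {(poly p x, poly q y) | p q. rel p q}"
proof
  fix a
  show "(to_ac a, to_ac a) \<in> {(poly p x, poly q y) | p q. rel p q}"
    using rel_const[of "[:a:]"]
    by (auto intro!: exI[of _ "[:to_ac a:]"] simp: map_poly_pCons)
next
  fix u v u' v'
  assume "(u, v) \<in> {(poly p x, poly q y) | p q. rel p q}" "(u', v') \<in> {(poly p x, poly q y) | p q. rel p q}"
  then obtain p q p' q' where "rel p q" "rel p' q'"
    and [simp]: "u = poly p x" "v = poly q y" "u' = poly p' x" "v' = poly q' y" by blast
  then have "rel (p + p') (q + q')" "rel (p * p') (q * q')" by (auto intro: rel_add rel_mult)
  moreover have "(u + u', v + v') = (poly (p + p') x, poly (q + q') y)"
    "(u * u', v * v') = (poly (p * p') x, poly (q * q') y)" by simp_all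
  ultimately show "(u + u', v + v') \<in> {(poly p x, poly q y) | p q. rel p q}"
    "(u * u', v * v') \<in> {(poly p x, poly q y) | p q. rel p q}" by blast+
qed (use assms in auto)

text \<open>\<open>x\<close> is sent to a root of the image of its minimal polynomial over the domain.\<close>

lemma extend:
  "\<exists>G'. partial_hom G' \<and> G \<subseteq> G' \<and> x \<in> Domain G'"
proof -
  define S where "S p \<longleftrightarrow> p \<noteq> 0 \<and> poly p x = 0 \<and> (\<exists>q. rel p q)" for p
  obtain r where "r \<noteq> 0" "poly (map_poly to_ac r) x = 0"
    using alg_closure_algebraic[of x] by metis
  then have "S (map_poly to_ac r)"
    using rel_const by (auto simp: S_def map_poly_eq_0_iff)
  define m where "m = arg_min Polynomial.degree S"
  have Sm: "S m" and min: "\<And>p. S p \<Longrightarrow> Polynomial.degree m \<le> Polynomial.degree p"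
    unfolding m_def using arg_min_nat_lemma[of S "map_poly to_ac r" Polynomial.degree] \<open>S (map_poly to_ac r)\<close> by auto
  then obtain m' where m: "rel m m'" "m \<noteq> 0" "poly m x = 0" by (auto simp: S_def)
  have "Polynomial.degree m \<noteq> 0"
    using m(2,3) by (metis degree_eq_zeroE mult_zero_right pCons_0_0 poly_const_conv)
  then obtain y where y: "poly m' y = 0"
    using alg_closed_imp_poly_has_root[of m'] rel_degree[OF m(1)] by auto
  \<comment> \<open>Division by \<open>m\<close>, done one leading term at a time so that the
    polynomials on both sides stay related. Minimality of \<open>m\<close> lets the process run down
    to 0, and multiples of \<open>m'\<close> vanish at \<open>y\<close>.\<close>
  have root: "poly q y = 0" if "rel p q" "poly p x = 0" for p q
    using that
  proof (induction "Polynomial.degree p" arbitrary: p q rule: less_induct)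
    case less
    show ?case
    proof (cases "p = 0")
      case True
      then show ?thesis using less.prems rel_0_left[of q] by simp
    next
      case False
      let ?d = "Polynomial.degree m" and ?e = "Polynomial.degree p"
      have le: "?d \<le> ?e" using min[of p] False less.prems by (auto simp: S_def)
      \<comment> \<open>\<open>c\<close> and \<open>c'\<close> are quotients of leading
        coefficients, taken at the same two indices on both sides so that \<open>G\<close> relates
        them.\<close>
      define c where "c = Polynomial.coeff p ?e * inverse (Polynomial.coeff m ?d)"
      define c' where "c' = Polynomial.coeff q ?e * inverse (Polynomial.coeff m' ?d)"
      define p1 where "p1 = p - Polynomial.monom c (?e - ?d) * m"
      define q1 where "q1 = q - Polynomial.monom c' (?e - ?d) * m'"
      have "(c, c') \<in> G"
        unfolding c_def c'_def using less.prems m(1) by (auto simp: rel_def intro!: mult inverse)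
      then have r: "rel p1 q1"
        unfolding p1_def q1_def using less.prems m(1) by (intro rel_diff rel_mult rel_monom)
      have z: "poly p1 x = 0" using less.prems m(3) by (simp add: p1_def)
      have "c \<noteq> 0" using False m(2) by (simp add: c_def)
      then have "Polynomial.degree (Polynomial.monom c (?e - ?d) * m) = ?e"
        using m(2) le by (simp add: degree_mult_eq monom_eq_0_iff degree_monom_eq)
      then have "Polynomial.degree p1 \<le> ?e"
        unfolding p1_def by (intro degree_diff_le) auto
      moreover have "Polynomial.coeff p1 ?e = 0"
        using le m(2) coeff_monom_mult[of c "?e - ?d" m ?e] by (simp add: p1_def c_def)
      ultimately have "p1 = 0 \<or> Polynomial.degree p1 < ?e"
        by (metis leading_coeff_0_iff le_neq_implies_less)
      then have "poly q1 y = 0"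
        using less.hyps[OF _ r z] r rel_0_left[of q1] by (cases "p1 = 0") auto
      then show ?thesis using y by (simp add: q1_def)
    qed
  qed
  let ?G = "{(poly p x, poly q y) | p q. rel p q}"
  have "G \<subseteq> ?G"
  proof clarify
    fix u v assume "(u, v) \<in> G"
    then have "rel [:u:] [:v:]" by (simp add: rel_pCons rel_0)
    then show "\<exists>p q. (u, v) = (poly p x, poly q y) \<and> rel p q" by force
  qed
  moreover have "rel [:0, 1:] [:0, 1:]" by (simp add: rel_pCons rel_0 zero one)
  then have "(poly [:0, 1:] x, poly [:0, 1:] y) \<in> ?G" by blast
  then have "x \<in> Domain ?G" by (auto simp del: poly_pCons) auto
  moreover have "partial_hom ?G" using root by (rule adjoin)
  ultimately show ?thesis by blast
qed

end

section \<open>Homomorphisms of the closure over the base field\<close>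

locale ac_aut =
  fixes \<sigma> :: "'a::field alg_closure \<Rightarrow> 'a alg_closure"
  assumes hom_add: "\<sigma> (x + y) = \<sigma> x + \<sigma> y"
    and hom_mult: "\<sigma> (x * y) = \<sigma> x * \<sigma> y"
    and hom_const: "\<sigma> (to_ac a) = to_ac a"
begin

lemma hom_0 [simp]: "\<sigma> 0 = 0"
  using hom_const[of 0] by simp

lemma hom_1 [simp]: "\<sigma> 1 = 1"
  using hom_const[of 1] by simp

lemma hom_uminus: "\<sigma> (- x) = - \<sigma> x"
  using hom_mult[of "to_ac (-1)" x] hom_const[of "-1"] by simp

lemma hom_diff: "\<sigma> (x - y) = \<sigma> x - \<sigma> y"
  using hom_add[of x "- y"] hom_uminus by simp

lemma hom_inverse: "\<sigma> (inverse x) = inverse (\<sigma> x)"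
proof (cases "x = 0")
  case False
  then have "\<sigma> x * \<sigma> (inverse x) = 1" by (simp flip: hom_mult)
  then show ?thesis by (simp add: inverse_unique)
qed simp

lemma hom_eq_0_iff [simp]: "\<sigma> x = 0 \<longleftrightarrow> x = 0"
proof
  assume "\<sigma> x = 0"
  then show "x = 0"
    using hom_mult[of x "inverse x"] by (cases "x = 0") auto
qed simp

lemma inj: "inj \<sigma>"
  by (rule injI) (metis eq_iff_diff_eq_0 hom_diff hom_eq_0_iff)

lemma hom_eq_iff [simp]: "\<sigma> x = \<sigma> y \<longleftrightarrow> x = y"
  using inj by (auto simp: inj_def)

lemma hom_poly: "\<sigma> (poly (map_poly to_ac p) x) = poly (map_poly to_ac p) (\<sigma> x)"
  by (induction p) (simp_all add: map_poly_pCons hom_add hom_mult hom_const)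

lemma in_ac_roots_iff: "\<sigma> x \<in> ac_roots p \<longleftrightarrow> x \<in> ac_roots p"
  by (simp add: ac_roots_def flip: hom_poly)

end

lemma finite_ac_roots: "p \<noteq> 0 \<Longrightarrow> finite (ac_roots p)"
  unfolding ac_roots_def by (rule poly_roots_finite) (simp add: map_poly_eq_0_iff)

context ac_aut
begin

lemma image_ac_roots: "p \<noteq> 0 \<Longrightarrow> \<sigma> ` ac_roots p = ac_roots p"
  by (rule card_subset_eq)
     (auto simp: finite_ac_roots in_ac_roots_iff intro!: card_image inj_onI)

text \<open>Surjectivity comes from algebraicity: each element lies in the finite root set of some
  nonzero polynomial over the base field, and the injective map \<open>\<sigma>\<close> permutes
  that set.\<close>

lemma bij: "bij \<sigma>"
proof -
  have "x \<in> range \<sigma>" for x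
  proof -
    obtain p where "p \<noteq> 0" "poly (map_poly to_ac p) x = 0"
      using alg_closure_algebraic[of x] by metis
    then show ?thesis using image_ac_roots[of p] by (auto simp: ac_roots_def)
  qed
  then show ?thesis using inj by (auto simp: bij_def)
qed

lemma ac_aut_inv: "ac_aut (inv_into UNIV \<sigma>)"
proof -
  let ?\<tau> = "inv_into UNIV \<sigma>"
  have [simp]: "\<sigma> (?\<tau> x) = x" for x
    using bij by (simp add: bij_is_surj surj_f_inv_f)
  have eqI: "?\<tau> x = y" if "x = \<sigma> y" for x y using that inj by simp
  show ?thesis by standard (auto intro!: eqI simp: hom_add hom_mult hom_const)
qed

lemma ac_aut_compose: "ac_aut \<tau> \<Longrightarrow> ac_aut (\<sigma> \<circ> \<tau>)"
  by (auto simp: ac_aut_def hom_add hom_mult hom_const)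

end

section \<open>Extension to the whole closure and conjugacy of roots\<close>

lemma partial_hom_extends_to_ac_aut:
  assumes "partial_hom G"
  obtains \<sigma> where "ac_aut \<sigma>" "\<And>x y. (x, y) \<in> G \<Longrightarrow> \<sigma> x = y"
proof -
  define E where "E = {H. partial_hom H \<and> G \<subseteq> H}"
  \<comment> \<open>Zorn's lemma for inclusion of graphs. The closure laws pass to the union of a
    chain because any two pairs already lie in one member of it.\<close>
  have "\<exists>M\<in>E. \<forall>H\<in>E. M \<subseteq> H \<longrightarrow> H = M"
  proof (rule subset_Zorn_nonempty)
    show "E \<noteq> {}" using assms by (auto simp: E_def)
    fix C assume C: "C \<noteq> {}" "subset.chain E C"
    have upper: "\<exists>H\<in>C. s \<in> H \<and> t \<in> H" if "s \<in> \<Union>C" "t \<in> \<Union>C" for s t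
      using that C(2) unfolding subset_chain_def by blast
    have ph: "partial_hom H" "G \<subseteq> H" if "H \<in> C" for H
      using C(2) that by (auto simp: subset_chain_def E_def)
    have "partial_hom (\<Union>C)"
    proof
      show "(to_ac a, to_ac a) \<in> \<Union>C" for a
        using C(1) ph(1) partial_hom.const by blast
      show "y = 0" if "(0, y) \<in> \<Union>C" for y
        using that ph(1) partial_hom.zero_left by blast
      fix x y x' y' assume "(x, y) \<in> \<Union>C" "(x', y') \<in> \<Union>C"
      then obtain H where H: "H \<in> C" "(x, y) \<in> H" "(x', y') \<in> H" using upper by blast
      then interpret partial_hom H using ph(1) by blast
      show "(x + x', y + y') \<in> \<Union>C" "(x * x', y * y') \<in> \<Union>C"
        using H add mult by blast+
    qed
    then show "\<Union>C \<in> E" using C(1) ph(2) by (auto simp: E_def)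
  qed
  then obtain M where M: "partial_hom M" "G \<subseteq> M"
    and max: "\<And>H. partial_hom H \<Longrightarrow> M \<subseteq> H \<Longrightarrow> H = M"
    by (auto simp: E_def)
  interpret M: partial_hom M by fact
  \<comment> \<open>By \<open>extend\<close>, a maximal graph omits no point.\<close>
  have "\<exists>y. (x, y) \<in> M" for x
    using M.extend[of x] max by blast
  then obtain \<sigma> where \<sigma>: "\<And>x. (x, \<sigma> x) \<in> M" by metis
  show ?thesis
  proof
    show "ac_aut \<sigma>"
      by standard (metis M.unique M.add M.mult M.const \<sigma>)+
    show "\<sigma> x = y" if "(x, y) \<in> G" for x y
      using that M(2) M.unique \<sigma> by blast
  qed
qed

text \<open>An irreducible \<open>p\<close> with root \<open>x\<close> divides every polynomial over
  the base field that vanishes at \<open>x\<close>. Therefore sending the value of \<open>q\<close>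
  at \<open>x\<close> to its value at \<open>y\<close> is well defined, and this map extends to the
  closure.\<close>

lemma irreducible_roots_conjugate:
  assumes "Factorial_Ring.irreducible p" and x: "x \<in> ac_roots p" and y: "y \<in> ac_roots p"
  obtains \<sigma> where "ac_aut \<sigma>" "\<sigma> x = y"
proof -
  have dvd: "p dvd q" if q: "poly (map_poly to_ac q) x = 0" for q
  proof (cases "q = 0")
    case False
    define P where "P r \<longleftrightarrow> r \<noteq> 0 \<and> poly (map_poly to_ac r) x = 0" for r
    \<comment> \<open>\<open>r\<close> is a minimal polynomial of \<open>x\<close>, found as a
      nonzero annihilator of least degree. It divides \<open>p\<close> and is no unit, so
      irreducibility makes \<open>p\<close> divide it in turn.\<close>
    define r where "r = arg_min Polynomial.degree P"
    have r: "P r" and min: "\<And>s. P s \<Longrightarrow> Polynomial.degree r \<le> Polynomial.degree s"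
      using arg_min_nat_lemma[of P q Polynomial.degree] q False by (auto simp: P_def r_def)
    have r_dvd: "r dvd s" if "poly (map_poly to_ac s) x = 0" for s
    proof (rule ccontr)
      assume "\<not> r dvd s"
      then have "s mod r \<noteq> 0" by (simp add: dvd_eq_mod_eq_0)
      moreover have "map_poly to_ac s = map_poly to_ac (s div r) * map_poly to_ac r + map_poly to_ac (s mod r)"
        by (simp flip: map_poly_to_ac_mult map_poly_to_ac_add)
      then have "poly (map_poly to_ac (s mod r)) x = 0"
        using that r by (simp add: P_def)
      ultimately have "P (s mod r)" by (simp add: P_def)
      then show False
        using min degree_mod_less'[of r s] r \<open>s mod r \<noteq> 0\<close> by (force simp: P_def)
    qed
    have "\<not> is_unit r"
    proof
      assume "is_unit r"
      then obtain c where "r = [:c:]" by (auto simp: is_unit_poly_iff)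
      then show False using r by (simp add: P_def map_poly_pCons)
    qed
    moreover have "r dvd p" using r_dvd x by (simp add: ac_roots_def)
    ultimately have "p dvd r" using assms(1) irreducibleD' by blast
    then show ?thesis using r_dvd[OF q] dvd_trans by blast
  qed simp
  let ?G = "{(poly (map_poly to_ac q) x, poly (map_poly to_ac q) y) | q. True}"
  have "partial_hom ?G"
  proof
    show "(to_ac a, to_ac a) \<in> ?G" for a
      by (auto intro!: exI[of _ "[:a:]"] simp: map_poly_pCons)
    show "v = 0" if v: "(0, v) \<in> ?G" for v
    proof -
      obtain q where q: "0 = poly (map_poly to_ac q) x" "v = poly (map_poly to_ac q) y"
        using v by blast
      from dvd[OF q(1)[symmetric]] obtain s where "q = p * s" by blast
      then show ?thesis using y q(2) by (simp add: ac_roots_def map_poly_to_ac_mult)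
    qed
  next
    fix u v u' v' assume "(u, v) \<in> ?G" "(u', v') \<in> ?G"
    then obtain q q' where "u = poly (map_poly to_ac q) x" "v = poly (map_poly to_ac q) y"
      "u' = poly (map_poly to_ac q') x" "v' = poly (map_poly to_ac q') y" by blast
    then have "(u + u', v + v') = (poly (map_poly to_ac (q + q')) x, poly (map_poly to_ac (q + q')) y)"
      "(u * u', v * v') = (poly (map_poly to_ac (q * q')) x, poly (map_poly to_ac (q * q')) y)"
      by (simp_all add: map_poly_to_ac_add map_poly_to_ac_mult)
    then show "(u + u', v + v') \<in> ?G" "(u * u', v * v') \<in> ?G" by blast+
  qed
  then obtain \<sigma> where "ac_aut \<sigma>" "\<And>u v. (u, v) \<in> ?G \<Longrightarrow> \<sigma> u = v"
    using partial_hom_extends_to_ac_aut by blast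
  moreover have "(x, y) \<in> ?G"
    by (auto intro!: exI[of _ "[:0, 1:]"] simp: map_poly_pCons)
  ultimately show ?thesis using that by blast
qed

subsection \<open>Splitting fields and towers\<close>

lemma ac_ring_simps [simp]:
  fixes x y :: "'a::field alg_closure"
  shows "carrier (ac_ring :: 'a alg_closure ring) = UNIV"
    "\<one>\<^bsub>ac_ring\<^esub> = (1 :: 'a alg_closure)" "\<zero>\<^bsub>ac_ring\<^esub> = (0 :: 'a alg_closure)"
    "x \<oplus>\<^bsub>ac_ring\<^esub> y = x + y" "x \<otimes>\<^bsub>ac_ring\<^esub> y = x * y" "\<ominus>\<^bsub>ac_ring\<^esub> x = - x"
    "x \<noteq> 0 \<Longrightarrow> inv\<^bsub>ac_ring\<^esub> x = inverse x"
proof -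
  interpret F: field "ac_ring :: 'a alg_closure ring"
    by (rule field_from_type_algebra)
  show "\<ominus>\<^bsub>ac_ring\<^esub> x = - x"
    by (rule F.minus_equality) (auto simp: ring_of_type_algebra_def)
  show "inv\<^bsub>ac_ring\<^esub> x = inverse x" if "x \<noteq> 0"
    by (rule F.comm_inv_char) (use that in \<open>auto simp: ring_of_type_algebra_def\<close>)
qed (simp_all add: ring_of_type_algebra_def)

lemma splitting_field_closed:
  fixes p :: "'a::field poly"
  shows to_ac_in_splitting_field: "to_ac a \<in> splitting_field p"
    and ac_roots_in_splitting_field: "x \<in> ac_roots p \<Longrightarrow> x \<in> splitting_field p"
    and splitting_field_uminus: "x \<in> splitting_field p \<Longrightarrow> - x \<in> splitting_field p"
    and splitting_field_inverse: "x \<in> splitting_field p \<Longrightarrow> inverse x \<in> splitting_field p"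
    and splitting_field_add: "x \<in> splitting_field p \<Longrightarrow> y \<in> splitting_field p \<Longrightarrow> x + y \<in> splitting_field p"
    and splitting_field_mult: "x \<in> splitting_field p \<Longrightarrow> y \<in> splitting_field p \<Longrightarrow> x * y \<in> splitting_field p"
  unfolding splitting_field_def
  using generate_field.a_inv[of x ac_ring] generate_field.m_inv[of x ac_ring]
    generate_field.eng_add[of x ac_ring _ y] generate_field.eng_mult[of x ac_ring _ y]
  by (auto intro: generate_field.incl) (cases "x = 0"; simp)

lemma splitting_field_induct [consumes 1, case_names const root uminus inverse add mult]:
  fixes x :: "'a::field alg_closure"
  assumes "x \<in> splitting_field p"
    and "\<And>a. Q (to_ac a)" "\<And>x. x \<in> ac_roots p \<Longrightarrow> Q x"
    and "\<And>x. Q x \<Longrightarrow> Q (- x)" "\<And>x. Q x \<Longrightarrow> Q (inverse x)"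
    and "\<And>x y. Q x \<Longrightarrow> Q y \<Longrightarrow> Q (x + y)" "\<And>x y. Q x \<Longrightarrow> Q y \<Longrightarrow> Q (x * y)"
  shows "Q x"
  using assms(1) unfolding splitting_field_def
proof (induction rule: generate_field.induct)
  case one
  then show ?case using assms(2)[of 1] by simp
qed (use assms(2-) in auto)

lemma subring_splitting_field: "subring (splitting_field p) ac_ring"
proof -
  interpret F: field "ac_ring :: 'a alg_closure ring"
    by (rule field_from_type_algebra)
  show ?thesis
    unfolding splitting_field_def using subfieldE(1)[OF F.generate_field_is_subfield] by simp
qed

lemma splitting_field_poly:
  assumes "x \<in> splitting_field p"
  shows "poly (map_poly to_ac q) x \<in> splitting_field p"
proof (induction q)
  case 0
  show ?case using to_ac_in_splitting_field[of 0] by simp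
next
  case (pCons a q)
  then show ?case
    using assms by (simp add: map_poly_pCons to_ac_in_splitting_field splitting_field_add splitting_field_mult)
qed

context ac_aut
begin

lemma in_splitting_field: "x \<in> splitting_field p \<Longrightarrow> \<sigma> x \<in> splitting_field p"
  by (induction rule: splitting_field_induct)
     (auto simp: hom_const hom_uminus hom_inverse hom_add hom_mult in_ac_roots_iff splitting_field_closed)

lemma image_splitting_field: "\<sigma> ` splitting_field p = splitting_field p"
proof
  show "\<sigma> ` splitting_field p \<subseteq> splitting_field p" using in_splitting_field by blast
  interpret inv: ac_aut "inv_into UNIV \<sigma>" by (rule ac_aut_inv)
  show "splitting_field p \<subseteq> \<sigma> ` splitting_field p"
  proof
    fix x assume "x \<in> splitting_field p"
    then have "inv_into UNIV \<sigma> x \<in> splitting_field p" by (rule inv.in_splitting_field)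
    moreover have "x = \<sigma> (inv_into UNIV \<sigma> x)" using bij by (simp add: bij_is_surj surj_f_inv_f)
    ultimately show "x \<in> \<sigma> ` splitting_field p" by blast
  qed
qed

text \<open>The points fixed by \<open>\<sigma>\<close> form a field over the base field, so fixing
  the generators is enough.\<close>

lemma fixes_splitting_field:
  assumes "\<And>x. x \<in> ac_roots p \<Longrightarrow> \<sigma> x = x" and "x \<in> splitting_field p"
  shows "\<sigma> x = x"
  using assms(2)
  by (induction rule: splitting_field_induct)
     (auto simp: hom_const hom_uminus hom_inverse hom_add hom_mult assms(1))

end

section \<open>Galois groups as restrictions of automorphisms of the closure\<close>

lemma carrier_galois_group_splitting_field:
  fixes p :: "'a::field poly"
  assumes "range to_ac \<subseteq> F" and "F \<subseteq> splitting_field p"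
  shows "carrier (galois_group ac_ring (splitting_field p) F) =
    {restrict \<sigma> (splitting_field p) | \<sigma>. ac_aut \<sigma> \<and> (\<forall>x\<in>F. \<sigma> x = x)}" (is "?C = ?D")
proof (intro equalityI subsetI)
  let ?L = "splitting_field p"
  fix \<tau> assume "\<tau> \<in> ?C"
  then have "\<tau> \<in> extensional ?L" and hom: "\<tau> \<in> ring_hom (ac_ring\<lparr>carrier := ?L\<rparr>) (ac_ring\<lparr>carrier := ?L\<rparr>)"
    and fixd: "\<And>x. x \<in> F \<Longrightarrow> \<tau> x = x"
    by (auto simp: galois_group_def Bij_def)
  have const: "\<tau> (to_ac a) = to_ac a" for a using fixd assms(1) by blast
  \<comment> \<open>The graph of \<open>\<tau>\<close> over the splitting field is a partial
    homomorphism, so \<open>\<tau>\<close> is the restriction of an automorphism of the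
    closure.\<close>
  have "partial_hom ((\<lambda>x. (x, \<tau> x)) ` ?L)"
  proof
    show "(to_ac a, to_ac a) \<in> (\<lambda>x. (x, \<tau> x)) ` ?L" for a
      using const[of a] to_ac_in_splitting_field by (metis imageI)
    show "y = 0" if "(0, y) \<in> (\<lambda>x. (x, \<tau> x)) ` ?L" for y
      using that const[of 0] by auto
  qed (use hom in \<open>auto simp: ring_hom_def splitting_field_closed intro!: image_eqI\<close>)
  then obtain \<sigma> where \<sigma>: "ac_aut \<sigma>" "\<And>x y. (x, y) \<in> (\<lambda>x. (x, \<tau> x)) ` ?L \<Longrightarrow> \<sigma> x = y"
    using partial_hom_extends_to_ac_aut by blast
  then have eq: "\<sigma> x = \<tau> x" if "x \<in> ?L" for x using that by blast
  then have "restrict \<sigma> ?L = \<tau>"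
    using \<open>\<tau> \<in> extensional ?L\<close> by (auto simp: fun_eq_iff extensional_def)
  moreover have "\<forall>x\<in>F. \<sigma> x = x" using eq fixd assms(2) by auto
  ultimately show "\<tau> \<in> ?D" using \<sigma>(1) by blast
next
  let ?L = "splitting_field p"
  fix \<tau> assume "\<tau> \<in> ?D"
  then obtain \<sigma> where \<tau>: "\<tau> = restrict \<sigma> ?L" and \<sigma>: "ac_aut \<sigma>" "\<forall>x\<in>F. \<sigma> x = x" by blast
  interpret ac_aut \<sigma> by fact
  have "\<tau> \<in> Bij ?L"
    using image_splitting_field[of p] inj by (auto simp: \<tau> Bij_def bij_betw_def inj_on_def)
  moreover have "\<tau> \<in> ring_hom (ac_ring\<lparr>carrier := ?L\<rparr>) (ac_ring\<lparr>carrier := ?L\<rparr>)"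
    using to_ac_in_splitting_field[of 1 p]
    by (auto simp: \<tau> ring_hom_def in_splitting_field splitting_field_closed hom_add hom_mult)
  ultimately show "\<tau> \<in> ?C"
    using \<sigma>(2) assms(2) by (auto simp: galois_group_def \<tau>)
qed

lemma poly_map_poly_pcompose:
  "poly (map_poly to_ac (pcompose p q)) x = poly (map_poly to_ac p) (poly (map_poly to_ac q) x)"
  by (induction p) (simp_all add: pcompose_pCons map_poly_to_ac_add map_poly_to_ac_mult map_poly_pCons)

lemma ac_roots_iter_comp_Suc:
  "y \<in> ac_roots (iter_comp \<theta> (Suc n)) \<longleftrightarrow>
    poly (map_poly to_ac (\<theta> (Suc n))) y \<in> ac_roots (iter_comp \<theta> n)"
  by (simp add: ac_roots_def poly_map_poly_pcompose)

lemma card_fibre_le: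
  fixes q :: "'a::field poly"
  assumes "Polynomial.degree q > 0"
  shows "finite {y. poly (map_poly to_ac q) y = b}"
    and "card {y. poly (map_poly to_ac q) y = b} \<le> Polynomial.degree q"
proof -
  let ?r = "map_poly to_ac q + [:- b:]"
  have "Polynomial.degree (map_poly to_ac q) = Polynomial.degree q"
    by (rule degree_map_poly) simp
  then have d: "Polynomial.degree ?r = Polynomial.degree q"
    using assms by (simp add: degree_add_eq_left)
  then have r: "?r \<noteq> 0" using assms by auto
  have eq: "{y. poly (map_poly to_ac q) y = b} = {y. poly ?r y = 0}" by auto
  show "finite {y. poly (map_poly to_ac q) y = b}"
    unfolding eq by (rule poly_roots_finite[OF r])
  show "card {y. poly (map_poly to_ac q) y = b} \<le> Polynomial.degree q"
    unfolding eq using card_poly_roots_bound[OF r] d by simp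
qed

section \<open>The tower of a sequence of quadratic polynomials\<close>

locale quadratic_tower =
  fixes \<theta> :: "nat \<Rightarrow> 'a::field_char_0 poly"
  assumes degree_2: "n \<ge> 1 \<Longrightarrow> Polynomial.degree (\<theta> n) = 2"
    and irreducible: "n \<ge> 1 \<Longrightarrow> Factorial_Ring.irreducible (iter_comp \<theta> n)"
begin

abbreviation K :: "nat \<Rightarrow> 'a alg_closure set" where
  "K n \<equiv> tower_field \<theta> n"

abbreviation roots :: "nat \<Rightarrow> 'a alg_closure set" where
  "roots n \<equiv> ac_roots (iter_comp \<theta> n)"

abbreviation step :: "nat \<Rightarrow> 'a alg_closure \<Rightarrow> 'a alg_closure" where
  "step n \<equiv> poly (map_poly to_ac (\<theta> n))"

lemma finite_roots: "finite (roots n)"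
proof (rule finite_ac_roots)
  show "iter_comp \<theta> n \<noteq> 0"
    using irreducible[of n] by (cases n) auto
qed

lemma roots_in_K: "x \<in> roots n \<Longrightarrow> x \<in> K n"
  by (simp add: tower_field_def ac_roots_in_splitting_field)

lemma step_surj: "\<exists>y. step (Suc n) y = x"
proof -
  have "Polynomial.degree (map_poly to_ac (\<theta> (Suc n)) + [:- x:]) > 0"
    by (subst degree_add_eq_left) (simp_all add: degree_map_poly degree_2)
  then obtain y where "poly (map_poly to_ac (\<theta> (Suc n)) + [:- x:]) y = 0"
    using alg_closed_imp_poly_has_root by blast
  then show ?thesis by auto
qed

text \<open>A root of level \<open>n\<close> has a preimage \<open>y\<close> under the next
  quadratic. This \<open>y\<close> is a root of level \<open>n + 1\<close>, and the old root is a
  polynomial value at it.\<close>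

lemma K_Suc: "K n \<subseteq> K (Suc n)"
proof
  fix x assume "x \<in> K n"
  then show "x \<in> K (Suc n)"
    unfolding tower_field_def
  proof (induction rule: splitting_field_induct)
    case (root x)
    obtain y where "step (Suc n) y = x" using step_surj by blast
    then show ?case
      using root ac_roots_in_splitting_field[of y "iter_comp \<theta> (Suc n)"] splitting_field_poly
      by (auto simp: ac_roots_iter_comp_Suc simp del: iter_comp.simps)
  qed (auto intro: splitting_field_closed)
qed

lemma K_mono: "m \<le> n \<Longrightarrow> K m \<subseteq> K n"
  using K_Suc by (rule lift_Suc_mono_le)

lemma to_ac_in_K: "range to_ac \<subseteq> K n"
  by (auto simp: tower_field_def to_ac_in_splitting_field)

lemma carrier_tower_group:
  "carrier (tower_group \<theta> n) = {restrict \<sigma> (K n) | \<sigma>. ac_aut \<sigma>}"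
  using carrier_galois_group_splitting_field[of "range to_ac" "iter_comp \<theta> n"] to_ac_in_K[of n]
  by (auto simp: tower_group_def tower_field_def ac_aut.hom_const)

lemma carrier_tower_kernel:
  "carrier (tower_kernel \<theta> (Suc n)) = {restrict \<sigma> (K (Suc n)) | \<sigma>. ac_aut \<sigma> \<and> (\<forall>x\<in>K n. \<sigma> x = x)}"
  using carrier_galois_group_splitting_field[of "K n" "iter_comp \<theta> (Suc n)"] to_ac_in_K[of n] K_Suc[of n]
  by (simp add: tower_kernel_def tower_field_def)

text \<open>An automorphism that fixes all roots of level \<open>n + 1\<close> fixes the field they
  generate, so a non-identity element of the kernel moves one of them.\<close>

lemma nontrivial_kernel_moves_root:
  assumes "\<not> trivial_group (tower_kernel \<theta> (Suc n))"
  obtains \<eta> y where "ac_aut \<eta>" "\<And>x. x \<in> K n \<Longrightarrow> \<eta> x = x" "y \<in> roots (Suc n)" "\<eta> y \<noteq> y"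
proof -
  \<comment> \<open>\<open>trivial_group\<close> includes the group property, so this is what turns
    its negation into a statement about the carrier alone.\<close>
  have "group (tower_kernel \<theta> (Suc n))"
    unfolding tower_kernel_def using K_Suc[of n]
    by (intro group_galois_group) (auto simp: tower_field_def subring_splitting_field)
  moreover have one: "\<one>\<^bsub>tower_kernel \<theta> (Suc n)\<^esub> = restrict id (K (Suc n))"
    by (simp add: tower_kernel_def galois_group_def BijGroup_def fun_eq_iff)
  ultimately have "carrier (tower_kernel \<theta> (Suc n)) \<noteq> {restrict id (K (Suc n))}"
    using assms by (simp add: trivial_group_def)
  moreover have "restrict id (K (Suc n)) \<in> carrier (tower_kernel \<theta> (Suc n))"
    unfolding carrier_tower_kernel by (auto intro!: exI[of _ id] simp: ac_aut_def)
  ultimately obtain \<tau> where "\<tau> \<in> carrier (tower_kernel \<theta> (Suc n))" "\<tau> \<noteq> restrict id (K (Suc n))"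
    by blast
  then obtain \<eta> where \<eta>: "ac_aut \<eta>" "\<And>x. x \<in> K n \<Longrightarrow> \<eta> x = x" "restrict \<eta> (K (Suc n)) \<noteq> restrict id (K (Suc n))"
    unfolding carrier_tower_kernel by auto
  then obtain x where "x \<in> K (Suc n)" "\<eta> x \<noteq> x" by (auto simp: fun_eq_iff split: if_splits)
  then obtain y where "y \<in> roots (Suc n)" "\<eta> y \<noteq> y"
    using ac_aut.fixes_splitting_field[OF \<eta>(1)] unfolding tower_field_def by metis
  then show ?thesis using \<eta> that by blast
qed

text \<open>Since the kernel is normal and the tower group is transitive on the roots of level \<open>n\<close>, one
  pair of roots exchanged by the kernel can be conjugated to any other pair.\<close>

lemma kernel_swaps_fibre:
  assumes "\<not> trivial_group (tower_kernel \<theta> (Suc n))" and n: "n \<ge> 1" and b: "b \<in> roots n"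
  obtains \<eta> y where "ac_aut \<eta>" "\<And>x. x \<in> K n \<Longrightarrow> \<eta> x = x" "\<eta> y \<noteq> y" "\<eta> (\<eta> y) = y"
    "{z. step (Suc n) z = b} = {y, \<eta> y}"
proof -
  obtain \<eta>0 y0 where \<eta>0: "ac_aut \<eta>0" "\<And>x. x \<in> K n \<Longrightarrow> \<eta>0 x = x"
    and y0: "y0 \<in> roots (Suc n)" "\<eta>0 y0 \<noteq> y0"
    using nontrivial_kernel_moves_root[OF assms(1)] by blast
  have "step (Suc n) y0 \<in> roots n" using y0(1) by (simp add: ac_roots_iter_comp_Suc del: iter_comp.simps)
  then obtain \<sigma> where \<sigma>: "ac_aut \<sigma>" "\<sigma> (step (Suc n) y0) = b"
    using irreducible_roots_conjugate[OF irreducible[OF n]] b by blast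
  interpret \<sigma>: ac_aut \<sigma> by fact
  interpret \<tau>: ac_aut "inv_into UNIV \<sigma>" by (rule \<sigma>.ac_aut_inv)
  have inv: "\<sigma> (inv_into UNIV \<sigma> x) = x" "inv_into UNIV \<sigma> (\<sigma> x) = x" for x
    using \<sigma>.bij \<sigma>.inj by (simp_all add: bij_is_surj surj_f_inv_f)
  \<comment> \<open>Conjugation by \<open>\<sigma>\<close> keeps \<open>K n\<close> fixed pointwise,
    because the inverse of \<open>\<sigma>\<close> maps \<open>K n\<close> into itself, and it
    carries the moved root \<open>y0\<close> to a moved root above \<open>b\<close>.\<close>
  define \<eta> where "\<eta> = \<sigma> \<circ> (\<eta>0 \<circ> inv_into UNIV \<sigma>)"
  define y where "y = \<sigma> y0"
  have aut: "ac_aut \<eta>"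
    unfolding \<eta>_def by (intro \<sigma>.ac_aut_compose ac_aut.ac_aut_compose \<eta>0 \<sigma>.ac_aut_inv)
  interpret \<eta>: ac_aut \<eta> by fact
  have fixd: "\<eta> x = x" if "x \<in> K n" for x
    using that \<eta>0(2) \<tau>.in_splitting_field[of x] by (simp add: \<eta>_def inv tower_field_def)
  have ne: "\<eta> y \<noteq> y" using y0(2) by (simp add: \<eta>_def y_def inv)
  have step_fixed: "step (Suc n) (\<eta> z) = b" if "step (Suc n) z = b" for z
    using \<eta>.hom_poly[of "\<theta> (Suc n)" z] fixd[OF roots_in_K[OF b]] that by simp
  have y: "step (Suc n) y = b" using \<sigma>(2) \<sigma>.hom_poly[of "\<theta> (Suc n)" y0] by (simp add: y_def)
  \<comment> \<open>Degree 2 enters here: the fibre has at most two points, and \<open>y\<close> and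
    \<open>\<eta> y\<close> are two distinct ones.\<close>
  have "card {z. step (Suc n) z = b} \<le> card {y, \<eta> y}" "finite {z. step (Suc n) z = b}"
    using card_fibre_le[of "\<theta> (Suc n)" b] degree_2[of "Suc n"] ne by auto
  moreover have "{y, \<eta> y} \<subseteq> {z. step (Suc n) z = b}" using y step_fixed by auto
  ultimately have fibre: "{z. step (Suc n) z = b} = {y, \<eta> y}"
    by (metis card_seteq)
  \<comment> \<open>\<open>\<eta>\<close> maps the fibre into itself and is injective, which rules
    out \<open>\<eta> (\<eta> y) = \<eta> y\<close>.\<close>
  have "\<eta> (\<eta> y) \<in> {y, \<eta> y}" using y step_fixed by (auto simp flip: fibre)
  then have "\<eta> (\<eta> y) = y" using ne by simp
  with aut fixd ne fibre show ?thesis using that by blast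
qed

section \<open>Elements of the limit group\<close>

abbreviation \<Gamma> :: "(nat \<Rightarrow> 'a alg_closure \<Rightarrow> 'a alg_closure) monoid" where
  "\<Gamma> \<equiv> limit_group \<theta>"

lemma carrier_limit_group:
  "\<omega> \<in> carrier \<Gamma> \<longleftrightarrow>
    (\<forall>n. \<omega> n \<in> carrier (tower_group \<theta> n)) \<and> (\<forall>n. restrict (\<omega> (Suc n)) (K n) = \<omega> n)"
  by (auto simp: limit_group_def inverse_limit_def tower_restrict_def)

lemma limit_component_restrict:
  assumes "\<omega> \<in> carrier \<Gamma>" "m \<le> n"
  shows "\<omega> m = restrict (\<omega> n) (K m)"
  using assms(2)
proof (induction rule: dec_induct)
  case base
  have "\<omega> m \<in> carrier (tower_group \<theta> m)" using assms(1) carrier_limit_group by blast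
  then show ?case unfolding carrier_tower_group by auto
next
  case (step n)
  have "K m \<subseteq> K n" using step K_mono by simp
  moreover have "\<omega> n = restrict (\<omega> (Suc n)) (K n)" using assms(1) by (simp add: carrier_limit_group)
  ultimately show ?case using step.IH by (auto simp: fun_eq_iff)
qed

text \<open>The component at level \<open>n\<close> is the restriction of an automorphism
  \<open>\<sigma>\<close> of the closure and determines all lower components, so on levels up to
  \<open>n\<close> computations can use \<open>\<sigma>\<close>.\<close>

lemma limit_component:
  assumes "\<omega> \<in> carrier \<Gamma>"
  obtains \<sigma> where "ac_aut \<sigma>" "\<And>m x. m \<le> n \<Longrightarrow> x \<in> K m \<Longrightarrow> \<omega> m x = \<sigma> x"
proof -
  obtain \<sigma> where \<sigma>: "ac_aut \<sigma>" "\<omega> n = restrict \<sigma> (K n)"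
    using assms carrier_tower_group[of n] unfolding carrier_limit_group by blast
  have "\<omega> m x = \<sigma> x" if "m \<le> n" "x \<in> K m" for m x
    using limit_component_restrict[OF assms that(1)] \<sigma>(2) that K_mono[of m n] by auto
  then show ?thesis using \<sigma>(1) that by blast
qed

text \<open>Image of an automorphism of the closure in the limit group; Haar invariance is applied
  to translation by such elements.\<close>

definition lift :: "('a alg_closure \<Rightarrow> 'a alg_closure) \<Rightarrow> nat \<Rightarrow> 'a alg_closure \<Rightarrow> 'a alg_closure" where
  "lift \<sigma> n = restrict \<sigma> (K n)"

lemma lift_in_carrier: "ac_aut \<sigma> \<Longrightarrow> lift \<sigma> \<in> carrier \<Gamma>"
  unfolding carrier_limit_group carrier_tower_group
  using K_Suc by (auto simp: lift_def inf.absorb_iff2)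

lemma lift_mult:
  assumes "ac_aut \<eta>" "\<omega> \<in> carrier \<Gamma>"
  shows "lift \<eta> \<otimes>\<^bsub>\<Gamma>\<^esub> \<omega> = (\<lambda>n. compose (K n) \<eta> (\<omega> n))"
    and "lift \<eta> \<otimes>\<^bsub>\<Gamma>\<^esub> \<omega> \<in> carrier \<Gamma>"
proof -
  have \<omega>: "\<exists>\<sigma>. ac_aut \<sigma> \<and> \<omega> n = restrict \<sigma> (K n)" for n
    using assms(2) carrier_tower_group[of n] unfolding carrier_limit_group by blast
  have bij: "restrict \<sigma> (K n) \<in> Bij (K n)" if "ac_aut \<sigma>" for \<sigma> n
    using carrier_tower_group[of n] that
    by (auto simp: tower_group_def galois_group_def)
  have mem: "\<omega> n x \<in> K n" if "x \<in> K n" for n x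
    using \<omega>[of n] ac_aut.in_splitting_field that unfolding tower_field_def by auto
  have "(lift \<eta> \<otimes>\<^bsub>\<Gamma>\<^esub> \<omega>) n = compose (K n) \<eta> (\<omega> n)" for n
  proof -
    have "\<omega> n \<in> Bij (K n)" using \<omega>[of n] bij by auto
    then have "(lift \<eta> \<otimes>\<^bsub>\<Gamma>\<^esub> \<omega>) n = compose (K n) (restrict \<eta> (K n)) (\<omega> n)"
      using bij[OF assms(1), of n]
      by (simp add: limit_group_def inverse_limit_def lift_def tower_group_def galois_group_def BijGroup_def)
    then show ?thesis using mem by (auto simp: compose_def fun_eq_iff)
  qed
  then show eq: "lift \<eta> \<otimes>\<^bsub>\<Gamma>\<^esub> \<omega> = (\<lambda>n. compose (K n) \<eta> (\<omega> n))" by blast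
  have "compose (K n) \<eta> (\<omega> n) \<in> carrier (tower_group \<theta> n)" for n
  proof -
    obtain \<sigma> where "ac_aut \<sigma>" "\<omega> n = restrict \<sigma> (K n)" using \<omega> by blast
    then show ?thesis
      unfolding carrier_tower_group using ac_aut.ac_aut_compose[OF assms(1)]
      by (auto intro!: exI[of _ "\<eta> \<circ> \<sigma>"] simp: compose_def fun_eq_iff)
  qed
  moreover have "restrict (compose (K (Suc n)) \<eta> (\<omega> (Suc n))) (K n) = compose (K n) \<eta> (\<omega> n)" for n
    using limit_component_restrict[OF assms(2), of n "Suc n"] K_Suc[of n]
    by (auto simp: compose_def fun_eq_iff)
  ultimately show "lift \<eta> \<otimes>\<^bsub>\<Gamma>\<^esub> \<omega> \<in> carrier \<Gamma>"
    by (simp add: eq carrier_limit_group)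
qed

end

subsection \<open>Haar measure on the limit group\<close>

locale haar_quadratic_tower = quadratic_tower \<theta> for \<theta> :: "nat \<Rightarrow> 'a::field_char_0 poly" +
  fixes P :: "(nat \<Rightarrow> 'a alg_closure \<Rightarrow> 'a alg_closure) measure"
  assumes haar: "haar_prob_measure (limit_group \<theta>) (limit_topology \<theta>) P"
begin

sublocale prob_space P
  using haar by (simp add: haar_prob_measure_def)

lemma space_P [simp]: "space P = carrier \<Gamma>"
  using haar by (simp add: haar_prob_measure_def)

text \<open>The event is a cylinder: the preimage of a subset of a discrete factor is open in the
  limit, hence Borel.\<close>

lemma component_event: "{\<omega> \<in> carrier \<Gamma>. Q (\<omega> n)} \<in> sets P"
proof -
  let ?T = "product_topology (\<lambda>n. discrete_topology (carrier (tower_group \<theta> n))) (UNIV :: nat set)"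
  have "continuous_map ?T (discrete_topology (carrier (tower_group \<theta> n))) (\<lambda>\<omega>. \<omega> n)"
    by (rule continuous_map_product_projection) simp
  from openin_continuous_map_preimage[OF this, of "{\<tau> \<in> carrier (tower_group \<theta> n). Q \<tau>}"]
  have "openin ?T {\<omega> \<in> topspace ?T. \<omega> n \<in> {\<tau> \<in> carrier (tower_group \<theta> n). Q \<tau>}}"
    by auto
  moreover have "{\<omega> \<in> carrier \<Gamma>. Q (\<omega> n)} =
      carrier \<Gamma> \<inter> {\<omega> \<in> topspace ?T. \<omega> n \<in> {\<tau> \<in> carrier (tower_group \<theta> n). Q \<tau>}}"
    by (auto simp: carrier_limit_group)
  moreover have "limit_topology \<theta> = subtopology ?T (carrier \<Gamma>)"
    by (simp add: limit_topology_def inverse_limit_topology_def limit_group_def)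
  ultimately have "openin (limit_topology \<theta>) {\<omega> \<in> carrier \<Gamma>. Q (\<omega> n)}"
    by (simp only: openin_subtopology_Int2)
  then show ?thesis
    using haar by (auto simp: haar_prob_measure_def)
qed

text \<open>The translate of \<open>F\<close> has the same mass and lies inside \<open>F'\<close>.
  Stated as an inequality, it asks only for an inclusion; equalities come from using it in both
  directions.\<close>

lemma measure_translate_le:
  assumes "ac_aut \<eta>" and "F \<in> sets P" "F' \<in> sets P"
    and "\<And>\<omega>. \<omega> \<in> F \<Longrightarrow> lift \<eta> \<otimes>\<^bsub>\<Gamma>\<^esub> \<omega> \<in> F'"
  shows "prob F \<le> prob F'"
proof -
  have "emeasure P F = emeasure P (lift \<eta> <#\<^bsub>\<Gamma>\<^esub> F)"
    using haar assms(2) lift_in_carrier[OF assms(1)] by (auto simp: haar_prob_measure_def)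
  also have "\<dots> \<le> emeasure P F'"
    using assms(3,4) by (intro emeasure_mono) (auto simp: l_coset_def)
  finally show ?thesis by (simp add: emeasure_eq_measure)
qed

text \<open>With \<open>b\<close> fixed, the two points above it are both fixed or swapped, and
  these events have equal mass. So twice the mass of the first is the mass of their union. The
  predicate \<open>Q\<close> carries an arbitrary condition on level \<open>n\<close>, later the
  history of the process.\<close>

lemma prob_fibre:
  assumes nontriv: "\<not> trivial_group (tower_kernel \<theta> (Suc n))" and n: "n \<ge> 1" and b: "b \<in> roots n"
  shows "(\<Sum>z | step (Suc n) z = b. prob {\<omega> \<in> carrier \<Gamma>. Q (\<omega> n) \<and> \<omega> (Suc n) z = z}) =
    prob {\<omega> \<in> carrier \<Gamma>. Q (\<omega> n) \<and> \<omega> n b = b}"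
proof -
  obtain \<eta> y where \<eta>: "ac_aut \<eta>" "\<And>x. x \<in> K n \<Longrightarrow> \<eta> x = x" "\<eta> y \<noteq> y" "\<eta> (\<eta> y) = y"
    and fibre: "{z. step (Suc n) z = b} = {y, \<eta> y}"
    using kernel_swaps_fibre[OF nontriv n b] by metis
  \<comment> \<open>By \<open>act\<close> below, \<open>F y y\<close> is the case of both points
    fixed and \<open>F y (\<eta> y)\<close> the swap, each under the condition
    \<open>Q\<close>.\<close>
  define F where "F u v = {\<omega> \<in> carrier \<Gamma>. Q (\<omega> n) \<and> \<omega> (Suc n) u = v}" for u v
  have F: "F u v \<in> sets P" for u v
  proof -
    \<comment> \<open>The condition at level \<open>n\<close> is read off from the component at
      level \<open>n + 1\<close>, so that a single component decides the event.\<close>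
    have "F u v = {\<omega> \<in> carrier \<Gamma>. Q (restrict (\<omega> (Suc n)) (K n)) \<and> \<omega> (Suc n) u = v}"
      by (auto simp: F_def carrier_limit_group)
    then show ?thesis using component_event[of "\<lambda>\<tau>. Q (restrict \<tau> (K n)) \<and> \<tau> u = v" "Suc n"] by simp
  qed
  have in_fibre: "z = y \<or> z = \<eta> y \<longleftrightarrow> step (Suc n) z = b" for z
    using fibre by auto
  have y: "y \<in> roots (Suc n)" "\<eta> y \<in> roots (Suc n)"
    using in_fibre[of y] in_fibre[of "\<eta> y"] b ac_roots_iter_comp_Suc[of _ \<theta> n] by simp_all
  \<comment> \<open>An element fixing \<open>b\<close> permutes the two points above it, so it fixes
    both or swaps them; if it moves \<open>b\<close>, it fixes neither.\<close>
  have act: "(\<omega> (Suc n) y = y \<longleftrightarrow> \<omega> (Suc n) (\<eta> y) = \<eta> y) \<and>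
      (\<omega> n b = b \<longleftrightarrow> \<omega> (Suc n) y = y \<or> \<omega> (Suc n) y = \<eta> y)" if \<omega>: "\<omega> \<in> carrier \<Gamma>" for \<omega>
  proof -
    obtain \<sigma> where \<sigma>: "ac_aut \<sigma>" "\<And>m x. m \<le> Suc n \<Longrightarrow> x \<in> K m \<Longrightarrow> \<omega> m x = \<sigma> x"
      using limit_component[OF \<omega>] by metis
    interpret ac_aut \<sigma> by fact
    have step: "step (Suc n) (\<sigma> z) = \<sigma> (step (Suc n) z)" for z by (simp add: hom_poly)
    have "step (Suc n) y = b" "step (Suc n) (\<eta> y) = b"
      using in_fibre[of y] in_fibre[of "\<eta> y"] by simp_all
    then have "\<sigma> b = b \<longleftrightarrow> \<sigma> y = y \<or> \<sigma> y = \<eta> y"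
      "\<sigma> b = b \<longleftrightarrow> \<sigma> (\<eta> y) = y \<or> \<sigma> (\<eta> y) = \<eta> y"
      using in_fibre[of "\<sigma> y"] in_fibre[of "\<sigma> (\<eta> y)"] by (simp_all add: step)
    moreover have "\<sigma> y \<noteq> \<sigma> (\<eta> y)" using \<eta>(3) by auto
    ultimately have "(\<sigma> y = y \<longleftrightarrow> \<sigma> (\<eta> y) = \<eta> y) \<and> (\<sigma> b = b \<longleftrightarrow> \<sigma> y = y \<or> \<sigma> y = \<eta> y)"
      by metis
    then show ?thesis using \<sigma>(2) y b roots_in_K by simp
  qed
  \<comment> \<open>Translation by \<open>\<eta>\<close> acts on values, so the value
    \<open>v\<close> at \<open>u\<close> becomes \<open>\<eta> v\<close>. The component at level
    \<open>n\<close> has values in \<open>K n\<close>, which \<open>\<eta>\<close> fixes pointwise,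
    so \<open>Q\<close> is preserved.\<close>
  have translate: "lift \<eta> \<otimes>\<^bsub>\<Gamma>\<^esub> \<omega> \<in> F u (\<eta> v)" if \<omega>: "\<omega> \<in> F u v" and u: "u \<in> roots (Suc n)" for u v \<omega>
  proof -
    have \<omega>\<Gamma>: "\<omega> \<in> carrier \<Gamma>" using \<omega> by (simp add: F_def)
    obtain \<sigma> where \<sigma>: "ac_aut \<sigma>" "\<And>m x. m \<le> n \<Longrightarrow> x \<in> K m \<Longrightarrow> \<omega> m x = \<sigma> x"
      using limit_component[OF \<omega>\<Gamma>] by metis
    have "compose (K n) \<eta> (\<omega> n) = restrict (\<omega> n) (K n)"
      using \<sigma> \<eta>(2) ac_aut.in_splitting_field[OF \<sigma>(1)]
      by (auto simp: compose_def fun_eq_iff tower_field_def)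
    also have "\<dots> = \<omega> n" using limit_component_restrict[OF \<omega>\<Gamma>, of n n] by simp
    finally show ?thesis
      using \<omega> lift_mult[OF \<eta>(1) \<omega>\<Gamma>] roots_in_K[OF u] by (simp add: F_def compose_def)
  qed
  \<comment> \<open>\<open>\<eta>\<close> swaps \<open>y\<close> and \<open>\<eta> y\<close>, so
    translation carries each of the two events into the other.\<close>
  have "prob (F y y) = prob (F y (\<eta> y))"
    using measure_translate_le[OF \<eta>(1) F[of y y] F[of y "\<eta> y"]]
      measure_translate_le[OF \<eta>(1) F[of y "\<eta> y"] F[of y y]]
      translate[OF _ y(1), of _ y] translate[OF _ y(1), of _ "\<eta> y"] \<eta>(4)
    by (auto intro!: antisym)
  moreover have "F (\<eta> y) (\<eta> y) = F y y" using act by (auto simp: F_def)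
  ultimately have "(\<Sum>z | step (Suc n) z = b. prob (F z z)) = prob (F y y) + prob (F y (\<eta> y))"
    unfolding fibre using \<eta>(3) by simp
  also have "\<dots> = prob (F y y \<union> F y (\<eta> y))"
    using \<eta>(3) F by (intro finite_measure_Union[symmetric]) (auto simp: F_def)
  also have "F y y \<union> F y (\<eta> y) = {\<omega> \<in> carrier \<Gamma>. Q (\<omega> n) \<and> \<omega> n b = b}"
    using act by (auto simp: F_def)
  finally show ?thesis by (simp add: F_def)
qed

section \<open>Conditional expectation of the number of fixed points\<close>

lemma fixed_point_process_eq_sum:
  assumes "\<omega> \<in> carrier \<Gamma>"
  shows "real_of_int (fixed_point_process \<theta> n \<omega>) =
    (\<Sum>y\<in>roots n. indicator {\<omega> \<in> carrier \<Gamma>. \<omega> n y = y} \<omega>)"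
proof -
  have "{x \<in> roots n. \<omega> n x = x} = roots n \<inter> {x. \<omega> n x = x}" by auto
  moreover have "(\<Sum>y\<in>roots n. indicator {\<omega> \<in> carrier \<Gamma>. \<omega> n y = y} \<omega>) =
      (\<Sum>y\<in>roots n. indicator {x. \<omega> n x = x} y :: real)"
    using assms by (intro sum.cong) (auto simp: indicator_def)
  ultimately show ?thesis
    using finite_roots by (simp add: fixed_point_process_def indicator_def of_bool_def sum.If_cases)
qed

text \<open>The count is a finite sum of indicators of fixing events, so it is integrable and
  linearity turns its integral into a sum of probabilities.\<close>

lemma
  assumes A: "A \<in> sets P"
  shows set_integrable_fixed_point_process:
      "set_integrable P A (\<lambda>\<omega>. real_of_int (fixed_point_process \<theta> n \<omega>))"
    and set_integral_fixed_point_process: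
      "(LINT \<omega>:A|P. real_of_int (fixed_point_process \<theta> n \<omega>)) =
        (\<Sum>y\<in>roots n. prob (A \<inter> {\<omega> \<in> carrier \<Gamma>. \<omega> n y = y}))"
proof -
  let ?E = "\<lambda>y. {\<omega> \<in> carrier \<Gamma>. \<omega> n y = y}"
  have E: "?E y \<in> sets P" for y by (rule component_event)
  have eq: "indicator A \<omega> *\<^sub>R real_of_int (fixed_point_process \<theta> n \<omega>) =
      (\<Sum>y\<in>roots n. indicator (A \<inter> ?E y) \<omega>)" if "\<omega> \<in> space P" for \<omega>
    using that by (simp add: fixed_point_process_eq_sum indicator_inter_arith sum_distrib_left)
  have int: "integrable P (\<lambda>\<omega>. \<Sum>y\<in>roots n. indicator (A \<inter> ?E y) \<omega> :: real)"
    using A E by (intro Bochner_Integration.integrable_sum integrable_real_indicator) (auto simp: emeasure_eq_measure)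
  have "integrable P (\<lambda>\<omega>. indicator A \<omega> *\<^sub>R real_of_int (fixed_point_process \<theta> n \<omega>)) \<longleftrightarrow>
      integrable P (\<lambda>\<omega>. \<Sum>y\<in>roots n. indicator (A \<inter> ?E y) \<omega> :: real)"
    by (rule Bochner_Integration.integrable_cong[OF refl eq])
  with int show "set_integrable P A (\<lambda>\<omega>. real_of_int (fixed_point_process \<theta> n \<omega>))"
    unfolding set_integrable_def by (rule iffD2[rotated])
  have "(LINT \<omega>:A|P. real_of_int (fixed_point_process \<theta> n \<omega>)) =
      (LINT \<omega>|P. (\<Sum>y\<in>roots n. indicator (A \<inter> ?E y) \<omega>))"
    unfolding set_lebesgue_integral_def by (rule Bochner_Integration.integral_cong[OF refl eq])
  also have "\<dots> = (\<Sum>y\<in>roots n. prob (A \<inter> ?E y))"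
    using A E sets.sets_into_space[OF A]
    by (subst Bochner_Integration.integral_sum) (auto simp: emeasure_eq_measure intro!: sum.cong arg_cong[of _ _ prob])
  finally show "(LINT \<omega>:A|P. real_of_int (fixed_point_process \<theta> n \<omega>)) =
      (\<Sum>y\<in>roots n. prob (A \<inter> ?E y))" .
qed

text \<open>Sorting the roots of level \<open>n + 1\<close> by their image at level \<open>n\<close>
  reduces the claim to one fibre at a time, where \<open>prob_fibre\<close> applies because
  \<open>A\<close> depends on level \<open>n\<close> only.\<close>

lemma set_integral_fixed_point_process_Suc:
  assumes "\<not> trivial_group (tower_kernel \<theta> (Suc n))" and "n \<ge> 1"
    and A: "A = {\<omega> \<in> carrier \<Gamma>. Q (\<omega> n)}"
  shows "(LINT \<omega>:A|P. real_of_int (fixed_point_process \<theta> (Suc n) \<omega>)) =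
    (LINT \<omega>:A|P. real_of_int (fixed_point_process \<theta> n \<omega>))"
proof -
  have sets: "A \<in> sets P" unfolding A by (rule component_event)
  have Int: "A \<inter> {\<omega> \<in> carrier \<Gamma>. \<omega> m y = y} = {\<omega> \<in> carrier \<Gamma>. Q (\<omega> n) \<and> \<omega> m y = y}" for m y
    using A by auto
  have "(\<Sum>y\<in>roots (Suc n). prob (A \<inter> {\<omega> \<in> carrier \<Gamma>. \<omega> (Suc n) y = y})) =
      (\<Sum>b\<in>roots n. \<Sum>y | y \<in> roots (Suc n) \<and> step (Suc n) y = b.
        prob (A \<inter> {\<omega> \<in> carrier \<Gamma>. \<omega> (Suc n) y = y}))"
    by (rule sum.group[symmetric]) (auto simp: finite_roots ac_roots_iter_comp_Suc simp del: iter_comp.simps)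
  \<comment> \<open>Every point above a root of level \<open>n\<close> is a root of level
    \<open>n + 1\<close>, so the inner sum runs over the whole fibre.\<close>
  also have "\<dots> = (\<Sum>b\<in>roots n. \<Sum>y | step (Suc n) y = b.
        prob {\<omega> \<in> carrier \<Gamma>. Q (\<omega> n) \<and> \<omega> (Suc n) y = y})"
    unfolding Int
    by (intro sum.cong refl) (auto simp: ac_roots_iter_comp_Suc simp del: iter_comp.simps)
  also have "\<dots> = (\<Sum>b\<in>roots n. prob (A \<inter> {\<omega> \<in> carrier \<Gamma>. \<omega> n b = b}))"
    unfolding Int using assms(1,2) by (intro sum.cong refl prob_fibre) 
  finally show ?thesis by (simp only: set_integral_fixed_point_process[OF sets])
qed

text \<open>The history up to index \<open>k - 1\<close> is an event at a single level. On it the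
  integral of the next count equals that of the last one, and the last count is constant.\<close>

lemma martingale_fixed_point_process:
  assumes n0: "n0 \<ge> 1" and nontriv: "\<And>n. n \<ge> n0 \<Longrightarrow> \<not> trivial_group (tower_kernel \<theta> n)"
  shows "martingale P (\<lambda>k. fixed_point_process \<theta> (n0 + k))"
  unfolding martingale_def Let_def
proof (intro conjI allI impI)
  fix k
  have "{\<omega> \<in> carrier \<Gamma>. fixed_point_process \<theta> n \<omega> = i} \<in> sets P" for n i
    unfolding fixed_point_process_def
    by (rule component_event[of "\<lambda>\<tau>. int (card {x \<in> roots n. \<tau> x = x}) = i"])
  moreover have "fixed_point_process \<theta> n -` {i} \<inter> space P = {\<omega> \<in> carrier \<Gamma>. fixed_point_process \<theta> n \<omega> = i}" for n i
    by auto
  ultimately show "fixed_point_process \<theta> (n0 + k) \<in> measurable P (count_space UNIV)"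
    by (subst measurable_count_space_eq_countable) auto
next
  fix k :: nat and t :: "nat \<Rightarrow> int"
  define A where "A = {\<omega> \<in> space P. \<forall>i<k. fixed_point_process \<theta> (n0 + i) \<omega> = t i}"
  assume "k \<ge> 1" and "prob {\<omega> \<in> space P. \<forall>i<k. fixed_point_process \<theta> (n0 + i) \<omega> = t i} > 0"
  then have pos: "prob A > 0" by (simp add: A_def)
  \<comment> \<open>\<open>n\<close> is the last level in the history; the process value at index
    \<open>k\<close> lives at level \<open>Suc n\<close>.\<close>
  define n where "n = n0 + (k - 1)"
  have n: "n \<ge> 1" "n \<ge> n0" "Suc n = n0 + k" using n0 \<open>k \<ge> 1\<close> by (auto simp: n_def)
  \<comment> \<open>Earlier components are restrictions of the one at level \<open>n\<close>, which
    lets \<open>Q\<close> recompute all earlier counts from it.\<close>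
  define Q where "Q \<tau> \<longleftrightarrow>
    (\<forall>i<k. int (card {x \<in> roots (n0 + i). restrict \<tau> (K (n0 + i)) x = x}) = t i)" for \<tau>
  have A: "A = {\<omega> \<in> carrier \<Gamma>. Q (\<omega> n)}"
  proof -
    have "restrict (\<omega> n) (K (n0 + i)) = \<omega> (n0 + i)" if "\<omega> \<in> carrier \<Gamma>" "i < k" for \<omega> i
      using limit_component_restrict[OF that(1), of "n0 + i" n] that(2) by (simp add: n_def)
    then show ?thesis by (auto simp: A_def Q_def fixed_point_process_def simp del: restrict_apply)
  qed
  then have sets: "A \<in> sets P" using component_event by simp
  have "(LINT \<omega>:A|P. real_of_int (fixed_point_process \<theta> (n0 + k) \<omega>)) =
      (LINT \<omega>:A|P. real_of_int (fixed_point_process \<theta> n \<omega>))"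
    using set_integral_fixed_point_process_Suc[OF _ n(1) A] nontriv[of "Suc n"] n by simp
  also have "\<dots> = (LINT \<omega>:A|P. real_of_int (t (k - 1)))"
  proof (rule set_lebesgue_integral_cong[OF sets], intro allI impI)
    fix \<omega> assume "\<omega> \<in> A"
    then have "\<forall>i<k. fixed_point_process \<theta> (n0 + i) \<omega> = t i" unfolding A_def by blast
    then have "fixed_point_process \<theta> n \<omega> = t (k - 1)"
      unfolding n_def by (rule allE[of _ "k - 1"]) (use \<open>k \<ge> 1\<close> in simp)
    then show "real_of_int (fixed_point_process \<theta> n \<omega>) = real_of_int (t (k - 1))" by simp
  qed
  also have "\<dots> = prob A * real_of_int (t (k - 1))"
    using sets.sets_into_space[OF sets] by (simp add: set_lebesgue_integral_def Int_absorb2)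
  finally show "event_expectation P (\<lambda>\<omega>. real_of_int (fixed_point_process \<theta> (n0 + k) \<omega>))
      {\<omega> \<in> space P. \<forall>i<k. fixed_point_process \<theta> (n0 + i) \<omega> = t i} = real_of_int (t (k - 1))"
    unfolding event_expectation_def A_def[symmetric] using pos by simp
  show "set_integrable P {\<omega> \<in> space P. \<forall>i<k. fixed_point_process \<theta> (n0 + i) \<omega> = t i}
      (\<lambda>\<omega>. real_of_int (fixed_point_process \<theta> (n0 + k) \<omega>))"
    unfolding A_def[symmetric] by (rule set_integrable_fixed_point_process[OF sets])
qed

end

theorem theorem6p6:
  fixes \<theta> :: "nat \<Rightarrow> 'a::field_char_0 poly"
    and P :: "(nat \<Rightarrow> 'a alg_closure \<Rightarrow> 'a alg_closure) measure"
  assumes "number_field TYPE('a)"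
    and "\<forall>n\<ge>1. Polynomial.degree (\<theta> n) = 2"
    and "\<forall>n\<ge>1. Factorial_Ring.irreducible (iter_comp \<theta> n)"
    and "haar_prob_measure (limit_group \<theta>) (limit_topology \<theta>) P"
    and "\<forall>\<^sub>F n in sequentially. \<not> trivial_group (tower_kernel \<theta> n)"
  shows "eventual_martingale P (fixed_point_process \<theta>)"
proof -
  interpret haar_quadratic_tower \<theta> P
    using assms(2-4) by unfold_locales auto
  obtain N where "\<And>n. n \<ge> N \<Longrightarrow> \<not> trivial_group (tower_kernel \<theta> n)"
    using assms(5) by (auto simp: eventually_sequentially)
  \<comment> \<open>The maximum with 1 keeps the start of the tail at a level where irreducibility
    gives transitivity on the roots.\<close>
  then have "martingale P (\<lambda>k. fixed_point_process \<theta> (max N 1 + k))"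
    by (intro martingale_fixed_point_process) auto
  then show ?thesis unfolding eventual_martingale_def by (intro exI[of _ "max N 1"]) auto
qed

end
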